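(* Let $n\ge 1$. The number of regions of the type $C$ Catalan arrangement $\mathcal{C}_{\{-1,0,1\}}(n)$ in $\mathbb{R}^n$ is $$r(\mathcal{C}_{\{-1,0,1\}}(n)) = 2^n\, n!\,\binom{2n}{n}.$$
   Context: The type $C$ Catalan arrangement $\mathcal{C}_{\{-1,0,1\}}(n)$ in $\mathbb{R}^n$ is the set of hyperplanes $x_i-x_j=s$, $x_i+x_j=s$ (for $1\le i<j\le n$) and $2x_i=s$ (for $1\le i\le n$), for all $s\in\{-1,0,1\}$. Its regions are the connected components of $\mathbb{R}^n\setminus\bigcup_{H\in\mathcal{C}_{\{-1,0,1\}}(n)}H$, and $r(\mathcal{C}_{\{-1,0,1\}}(n))$ denotes their number. *)

theory Defs
  imports "HOL-Analysis.Analysis"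
begin

text \<open>
  The space \<open>R^n\<close> is \<^const>\<open>Euclidean_space\<close>\<open> n\<close>: the sequences \<open>x :: nat \<Rightarrow> real\<close> with \<open>x i = 0\<close>
  for \<open>i \<ge> n\<close>, in the topology induced by the product topology. The coordinates
  \<open>x_1, ..., x_n\<close> are therefore \<open>x 0, ..., x (n - 1)\<close>.
\<close>

definition type_C_arrangement :: "real set \<Rightarrow> nat \<Rightarrow> (nat \<Rightarrow> real) set set" where
  "type_C_arrangement S n =
     {{x \<in> topspace (Euclidean_space n). x i - x j = s} | i j s. i < j \<and> j < n \<and> s \<in> S} \<union>
     {{x \<in> topspace (Euclidean_space n). x i + x j = s} | i j s. i < j \<and> j < n \<and> s \<in> S} \<union>
     {{x \<in> topspace (Euclidean_space n). 2 * x i = s} | i s. i < n \<and> s \<in> S}"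

definition type_C_Catalan :: "nat \<Rightarrow> (nat \<Rightarrow> real) set set" where
  "type_C_Catalan n = type_C_arrangement {-1, 0, 1} n"

definition regions :: "nat \<Rightarrow> (nat \<Rightarrow> real) set set \<Rightarrow> (nat \<Rightarrow> real) set set" where
  "regions n A =
     connected_components_of
       (subtopology (Euclidean_space n) (topspace (Euclidean_space n) - \<Union>A))"

text \<open>
  \<^const>\<open>card\<close> is 0 on infinite sets, so an equation \<open>num_regions n A = k\<close> with \<open>k > 0\<close>
  also states that there are finitely many regions.
\<close>

definition num_regions :: "nat \<Rightarrow> (nat \<Rightarrow> real) set set \<Rightarrow> nat" where
  "num_regions n A = card (regions n A)"

end

theory Submission
  imports Defs "HOL-Combinatorics.Permutations"
begin

text \<open>
  The regions are convex, hence they correspond to the sign patterns of the linear forms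
  \<open>\<plusminus> x i \<plusminus> x j - s\<close> on the complement of the arrangement. The hyperplanes \<open>x i = \<plusminus> x j\<close> and \<open>x i = 0\<close>
  belong to the arrangement, so the group of signed permutations, of order \<open>2 ^ n * fact n\<close>, acts
  freely on the regions, and it remains to count those with \<open>0 < x 0 < \<dots> < x (n - 1)\<close>.

  These are built by adding coordinates in increasing order. A new largest coordinate is constrained
  only by its position among the thresholds \<open>1/2\<close> and \<open>1 \<plusminus> x i\<close>, whose relative order is constant on
  each region. If \<open>k\<close> thresholds exceed the last coordinate, then a new one can have any
  \<open>j \<le> k\<close> of them above it, and afterwards \<open>j + 1\<close> thresholds exceed the last coordinate (or all
  \<open>2 * n + 3\<close>, when all \<open>2 * n + 1\<close> old ones do). The generating tree of this succession rule is
  counted by ballot numbers.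
\<close>

section \<open>Sign patterns\<close>

definition signs :: "real set" where
  "signs = {-1, 1}"

definition shifts :: "real set" where
  "shifts = {-1, 0, 1}"

text \<open>All ordered pairs and both signs are recorded, so that a signed permutation merely
  reindexes the tuples. The diagonal with \<open>a = b\<close> yields the forms
  \<open>2 * x i\<close> and their negatives; with \<open>a = - b\<close> the form is zero and
  carries no information.\<close>

definition sign_pattern :: "nat \<Rightarrow> (nat \<Rightarrow> real) \<Rightarrow> (nat \<times> nat \<times> real \<times> real \<times> real) set" where
  "sign_pattern n x =
     {(i, j, a, b, s). i < n \<and> j < n \<and> a \<in> signs \<and> b \<in> signs \<and> s \<in> shifts \<and>
        a * x i + b * x j < s}"

text \<open>The guard on the diagonal excludes the zero form, whose value \<open>0\<close> lies in
  \<open>shifts\<close>.\<close>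

definition generic :: "nat \<Rightarrow> (nat \<Rightarrow> real) \<Rightarrow> bool" where
  "generic n x \<longleftrightarrow>
     (\<forall>i<n. \<forall>j<n. \<forall>a\<in>signs. \<forall>b\<in>signs. \<forall>s\<in>shifts.
        (i = j \<longrightarrow> a = b) \<longrightarrow> a * x i + b * x j \<noteq> s)"

lemma sign_pattern_eq_iff:
  "sign_pattern n x = sign_pattern n y \<longleftrightarrow>
     (\<forall>i<n. \<forall>j<n. \<forall>a\<in>signs. \<forall>b\<in>signs. \<forall>s\<in>shifts.
        a * x i + b * x j < s \<longleftrightarrow> a * y i + b * y j < s)" (is "?L \<longleftrightarrow> ?R")
proof
  assume "sign_pattern n x = sign_pattern n y"
  then have "(i, j, a, b, s) \<in> sign_pattern n x \<longleftrightarrow> (i, j, a, b, s) \<in> sign_pattern n y" for i j a b s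
    by simp
  then show ?R
    unfolding sign_pattern_def mem_Collect_eq prod.case by blast
qed (auto simp: sign_pattern_def)

lemma sign_pattern_eqD:
  assumes "sign_pattern n x = sign_pattern n y" "i < n" "j < n" "a \<in> signs" "b \<in> signs"
    "s \<in> shifts"
  shows "a * x i + b * x j < s \<longleftrightarrow> a * y i + b * y j < s"
  using assms unfolding sign_pattern_eq_iff by simp

lemma sign_pattern_cong:
  assumes "\<And>i. i < n \<Longrightarrow> x i = y i"
  shows "sign_pattern n x = sign_pattern n y"
  unfolding sign_pattern_eq_iff using assms by simp

lemma sign_pattern_eq_mono:
  assumes "sign_pattern n x = sign_pattern n y" "m \<le> n"
  shows "sign_pattern m x = sign_pattern m y"
  using assms unfolding sign_pattern_eq_iff by simp

lemma genericD:
  assumes "generic n x" "i < n" "j < n" "a \<in> signs" "b \<in> signs" "s \<in> shifts"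
    "i = j \<Longrightarrow> a = b"
  shows "a * x i + b * x j \<noteq> s"
  using assms unfolding generic_def by simp

lemma generic_cong:
  assumes "\<And>i. i < n \<Longrightarrow> x i = y i"
  shows "generic n x \<longleftrightarrow> generic n y"
  unfolding generic_def using assms by simp

lemma finite_sign_patterns: "finite (sign_pattern n ` A)"
proof -
  have "sign_pattern n ` A \<subseteq>
      Pow ({..<n} \<times> {..<n} \<times> signs \<times> signs \<times> shifts)"
    unfolding sign_pattern_def by auto
  then show ?thesis
    by (rule finite_subset) (simp add: signs_def shifts_def)
qed

text \<open>Two maps with the same fibres on \<open>A\<close> have images in bijection. This lets
  classes be counted by any complete invariant.\<close>

lemma card_image_eq_card_image:
  assumes "\<And>x y. x \<in> A \<Longrightarrow> y \<in> A \<Longrightarrow> f x = f y \<longleftrightarrow> g x = g y"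
  shows "card (f ` A) = card (g ` A)"
proof -
  define h where "h = (\<lambda>u. g (inv_into A f u))"
  have h: "h (f x) = g x" if "x \<in> A" for x
  proof -
    have "inv_into A f (f x) \<in> A" "f (inv_into A f (f x)) = f x"
      using that by (auto intro: inv_into_into f_inv_into_f)
    then show ?thesis
      unfolding h_def using assms that by blast
  qed
  have "inj_on h (f ` A)"
    using h assms by (auto intro!: inj_onI)
  moreover have "h ` f ` A = g ` A"
    using h by (force simp: image_image)
  ultimately show ?thesis
    by (metis card_image)
qed

section \<open>Regions as sign patterns\<close>

lemma continuous_map_signed_sum:
  "continuous_map (Euclidean_space n) euclideanreal (\<lambda>x. a * x i + b * x j)"
proof -
  have p: "continuous_map (Euclidean_space n) euclideanreal (\<lambda>x. x k)" for k
    unfolding Euclidean_space_def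
    by (rule continuous_map_from_subtopology, rule continuous_map_product_projection) simp
  show ?thesis
    by (intro continuous_intros p)
qed

lemma continuous_map_segment:
  assumes "x \<in> topspace (Euclidean_space n)" "y \<in> topspace (Euclidean_space n)"
  shows "continuous_map (top_of_set {0..1}) (Euclidean_space n)
           (\<lambda>u i. (1 - u) * x i + u * y i)"
proof -
  have "continuous_on {0..1::real} (\<lambda>u. (1 - u) * x i + u * y i)" for i
    by (intro continuous_intros)
  then show ?thesis
    using assms unfolding Euclidean_space_def continuous_map_in_subtopology
    by (auto simp: topspace_Euclidean_space continuous_map_componentwise_UNIV)
qed

text \<open>Up to a global sign and the order of the indices, the nonzero signed forms are exactly
  those defining the hyperplanes, and \<open>shifts\<close> is closed under negation.\<close>

lemma topspace_minus_type_C_Catalan: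
  "topspace (Euclidean_space n) - \<Union>(type_C_Catalan n) =
     {x \<in> topspace (Euclidean_space n). generic n x}" (is "?L = ?R")
proof (intro set_eqI iffI)
  fix x assume "x \<in> ?L"
  then have x: "x \<in> topspace (Euclidean_space n)"
    and notin: "\<And>H. H \<in> type_C_Catalan n \<Longrightarrow> x \<notin> H"
    by auto
  have pair: "x i - x j \<noteq> s" "x i + x j \<noteq> s" if "i < j" "j < n" "s \<in> shifts" for i j s
  proof -
    have "{x \<in> topspace (Euclidean_space n). x i - x j = s} \<in> type_C_Catalan n"
      "{x \<in> topspace (Euclidean_space n). x i + x j = s} \<in> type_C_Catalan n"
      using that unfolding type_C_Catalan_def type_C_arrangement_def shifts_def[symmetric] by blast+
    from this[THEN notin] show "x i - x j \<noteq> s" "x i + x j \<noteq> s"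
      using x by simp_all
  qed
  have double: "2 * x i \<noteq> s" if "i < n" "s \<in> shifts" for i s
  proof -
    have "{x \<in> topspace (Euclidean_space n). 2 * x i = s} \<in> type_C_Catalan n"
      using that unfolding type_C_Catalan_def type_C_arrangement_def shifts_def[symmetric] by blast
    from notin[OF this] show ?thesis
      using x by simp
  qed
  have "a * x i + b * x j \<noteq> s"
    if h: "i < n" "j < n" "a \<in> signs" "b \<in> signs" "s \<in> shifts" "i = j \<longrightarrow> a = b"
    for i j a b s
  proof -
    have s: "- s \<in> shifts"
      using h unfolding shifts_def by auto
    consider "i < j" | "j < i" | "i = j" by linarith
    then show ?thesis
    proof cases
      case 1
      show ?thesis
        using h(3,4)[unfolded signs_def] pair[OF 1 h(2) h(5)] pair[OF 1 h(2) s] by auto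
    next
      case 2
      show ?thesis
        using h(3,4)[unfolded signs_def] pair[OF 2 h(1) h(5)] pair[OF 2 h(1) s] by auto
    next
      case 3
      then show ?thesis
        using h(3,4,6)[unfolded signs_def] double[OF h(1) h(5)] double[OF h(1) s] by auto
    qed
  qed
  then show "x \<in> ?R"
    using x unfolding generic_def by auto
next
  fix x assume x: "x \<in> ?R"
  then have g: "generic n x" by simp
  have "x i - x j \<notin> shifts" "x i + x j \<notin> shifts" if "i < j" "j < n" for i j
    using genericD[OF g, of i j 1 "-1"] genericD[OF g, of i j 1 1] that by (auto simp: signs_def)
  moreover have "2 * x i \<notin> shifts" if "i < n" for i
    using genericD[OF g, of i i 1 1] that by (auto simp: signs_def)
  ultimately show "x \<in> ?L"
    using x by (auto simp: type_C_Catalan_def type_C_arrangement_def simp flip: shifts_def)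
qed

text \<open>A connected set avoiding a hyperplane is mapped by its form to an interval missing
  \<open>s\<close>, hence stays on one side. Conversely, the segment joining two generic points with
  the same pattern crosses no hyperplane.\<close>

lemma num_regions_eq_card_sign_patterns:
  "num_regions n (type_C_Catalan n) = card (sign_pattern n ` {x. generic n x})"
proof -
  define U where "U = {x \<in> topspace (Euclidean_space n). generic n x}"
  define X where "X = subtopology (Euclidean_space n) U"
  have top: "topspace X = U"
    unfolding X_def U_def by auto
  have same_pattern: "sign_pattern n x = sign_pattern n y"
    if T: "connectedin X T" and xy: "x \<in> T" "y \<in> T" for x y T
    unfolding sign_pattern_eq_iff
  proof (intro allI impI ballI)
    fix i j a b s
    assume ij: "i < n" "j < n" and ab: "a \<in> signs" "b \<in> signs"
      and s: "s \<in> shifts"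
    show "a * x i + b * x j < s \<longleftrightarrow> a * y i + b * y j < s"
    proof (cases "i = j \<longrightarrow> a = b")
      case True
      let ?f = "\<lambda>z. a * z i + b * z j"
      have "continuous_map X euclideanreal ?f"
        unfolding X_def by (intro continuous_map_from_subtopology continuous_map_signed_sum)
      then have "connectedin euclideanreal (?f ` T)"
        using T by (rule connectedin_continuous_map_image)
      then have iv: "is_interval (?f ` T)"
        by (simp add: is_interval_connected_1)
      have "T \<subseteq> U"
        using connectedin_subset_topspace[OF T] top by simp
      then have "s \<notin> ?f ` T"
        using genericD[of n _ i j a b s] ij ab s True unfolding U_def by auto
      then show ?thesis
        using iv xy unfolding is_interval_1 by (smt (verit) image_eqI)
    next
      case False
      then have "a * z i + b * z j = 0" for z :: "nat \<Rightarrow> real"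
        using ab by (auto simp: signs_def)
      then show ?thesis by simp
    qed
  qed
  have comp: "connected_component_of X x y \<longleftrightarrow> sign_pattern n x = sign_pattern n y"
    if x: "x \<in> U" and y: "y \<in> U" for x y
  proof
    assume "connected_component_of X x y"
    then show "sign_pattern n x = sign_pattern n y"
      unfolding connected_component_of_def using same_pattern by blast
  next
    assume eq: "sign_pattern n x = sign_pattern n y"
    let ?g = "\<lambda>u i. (1 - u) * x i + u * y i"
    have xy: "x \<in> topspace (Euclidean_space n)" "y \<in> topspace (Euclidean_space n)"
      "generic n x" "generic n y"
      using x y unfolding U_def by auto
    have gen: "generic n (?g u)" if u: "0 \<le> u" "u \<le> 1" for u
      unfolding generic_def
    proof (intro allI impI ballI)
      fix i j a b s
      assume h: "i < n" "j < n" "a \<in> signs" "b \<in> signs" "s \<in> shifts"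
        "i = j \<longrightarrow> a = b"
      define p where "p = a * x i + b * x j"
      define q where "q = a * y i + b * y j"
      have pq: "p \<noteq> s" "q \<noteq> s" "p < s \<longleftrightarrow> q < s"
        unfolding p_def q_def
        using genericD[OF xy(3) h(1-5)] genericD[OF xy(4) h(1-5)] sign_pattern_eqD[OF eq h(1-5)] h(6)
        by auto
      have "a * ?g u i + b * ?g u j = (1 - u) * p + u * q"
        unfolding p_def q_def by (simp add: algebra_simps)
      \<comment> \<open>Both end values lie strictly on the same side of \<open>s\<close>, hence so
        does every convex combination.\<close>
      moreover have "(1 - u) * p + u * q \<noteq> s"
      proof (cases "p < s")
        case True
        then show ?thesis
          using convex_bound_lt[of p s q "1 - u" u] pq u by auto
      next
        case False
        then have "-p < -s" "-q < -s" using pq by auto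
        then show ?thesis
          using convex_bound_lt[of "-p" "-s" "-q" "1 - u" u] u by auto
      qed
      ultimately show "a * ?g u i + b * ?g u j \<noteq> s" by simp
    qed
    have cont: "continuous_map (top_of_set {0..1}) (Euclidean_space n) ?g"
      using xy by (intro continuous_map_segment)
    then have "?g ` {0..1} \<subseteq> topspace (Euclidean_space n)"
      using continuous_map_image_subset_topspace by fastforce
    then have "?g ` {0..1} \<subseteq> U"
      unfolding U_def using gen by auto
    with cont have "continuous_map (top_of_set {0..1}) X ?g"
      unfolding X_def by (auto simp: continuous_map_in_subtopology)
    moreover have "connectedin (top_of_set {0..1::real}) {0..1}"
      by (simp add: connectedin_subtopology)
    ultimately have "connectedin X (?g ` {0..1})"
      by (rule connectedin_continuous_map_image)
    moreover have "x \<in> ?g ` {0..1}" "y \<in> ?g ` {0..1}"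
      by (rule image_eqI[of _ _ 0]; simp) (rule image_eqI[of _ _ 1]; simp)
    ultimately show "connected_component_of X x y"
      unfolding connected_component_of_def by blast
  qed
  have "num_regions n (type_C_Catalan n) = card (connected_components_of X)"
    unfolding num_regions_def regions_def topspace_minus_type_C_Catalan X_def U_def ..
  also have "connected_components_of X = connected_component_of_set X ` U"
    unfolding connected_components_of_def top ..
  also have "card \<dots> = card (sign_pattern n ` U)"
  proof (rule card_image_eq_card_image)
    fix x y assume "x \<in> U" "y \<in> U"
    then show "connected_component_of_set X x = connected_component_of_set X y \<longleftrightarrow>
        sign_pattern n x = sign_pattern n y"
      using comp top by (metis connected_component_of_equiv connected_component_of_refl mem_Collect_eq)
  qed
  also have "sign_pattern n ` U = sign_pattern n ` {x. generic n x}"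
  proof (intro equalityI subsetI)
    fix P assume "P \<in> sign_pattern n ` {x. generic n x}"
    then obtain x where x: "generic n x" "P = sign_pattern n x" by auto
    \<comment> \<open>Points in \<open>generic\<close> are arbitrary sequences; truncation moves
      them into the Euclidean space without changing the pattern.\<close>
    define y where "y = (\<lambda>i. if i < n then x i else 0)"
    have "y \<in> U"
      using x generic_cong[of n x y] unfolding U_def y_def topspace_Euclidean_space by auto
    moreover have "P = sign_pattern n y"
      using x sign_pattern_cong[of n x y] unfolding y_def by auto
    ultimately show "P \<in> sign_pattern n ` U" by auto
  qed (auto simp: U_def)
  finally show ?thesis .
qed


section \<open>Reduction to the dominant chamber\<close>

text \<open>This cuts out a fundamental chamber for the signed permutations: every orbit of a
  generic point meets it.\<close>

definition dominant :: "nat \<Rightarrow> (nat \<Rightarrow> real) \<Rightarrow> bool" where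
  "dominant n x \<longleftrightarrow> generic n x \<and> (\<forall>i<n. 0 < x i) \<and> (\<forall>i<n. \<forall>j<i. x j < x i)"

definition signed_permute :: "nat set \<Rightarrow> (nat \<Rightarrow> nat) \<Rightarrow> (nat \<Rightarrow> real) \<Rightarrow> nat \<Rightarrow> real" where
  "signed_permute S p x = (\<lambda>i. (if i \<in> S then -1 else 1) * x (p i))"

definition negatives :: "nat \<Rightarrow> (nat \<Rightarrow> real) \<Rightarrow> nat set" where
  "negatives n x = {i. i < n \<and> x i < 0}"

text \<open>The value \<open>i\<close> outside the range makes this a permutation of
  \<open>{..<n}\<close> in the sense of \<open>permutes\<close>.\<close>

definition abs_rank :: "nat \<Rightarrow> (nat \<Rightarrow> real) \<Rightarrow> nat \<Rightarrow> nat" where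
  "abs_rank n x i = (if i < n then card {j. j < n \<and> \<bar>x j\<bar> < \<bar>x i\<bar>} else i)"

text \<open>Applying \<open>inv p\<close> carries the sign at index \<open>inv p k\<close> to index
  \<open>k\<close>, so the sign set has to be transported accordingly.\<close>

lemma signed_permute_inverse:
  assumes "p permutes A"
  shows "signed_permute {k. inv p k \<in> S} (inv p) (signed_permute S p x) = x"
  using permutes_inverses[OF assms] by (auto simp: signed_permute_def fun_eq_iff)

lemma signed_permute_sum:
  "a * signed_permute S p x i + b * signed_permute S p x j =
     (a * (if i \<in> S then -1 else 1)) * x (p i) + (b * (if j \<in> S then -1 else 1)) * x (p j)"
  by (simp add: signed_permute_def)

lemma signs_flip: "a \<in> signs \<Longrightarrow> a * (if P then -1 else 1) \<in> signs"
  by (auto simp: signs_def)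

lemma generic_signed_permute:
  assumes "generic n x" "p permutes {..<n}"
  shows "generic n (signed_permute S p x)"
  unfolding generic_def
proof (intro allI ballI impI)
  fix i j a b s
  assume h: "i < n" "j < n" "a \<in> signs" "b \<in> signs" "s \<in> shifts" "i = j \<longrightarrow> a = b"
  have "p i < n" "p j < n"
    using permutes_in_image[OF assms(2)] h(1,2) by auto
  moreover have "p i = p j \<Longrightarrow> i = j"
    using permutes_inj[OF assms(2)] by (rule injD)
  ultimately show "a * signed_permute S p x i + b * signed_permute S p x j \<noteq> s"
    unfolding signed_permute_sum using h by (intro genericD[OF assms(1)] signs_flip) auto
qed

lemma sign_pattern_signed_permuteI:
  assumes "sign_pattern n x = sign_pattern n y" "p permutes {..<n}"
  shows "sign_pattern n (signed_permute S p x) = sign_pattern n (signed_permute S p y)"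
  unfolding sign_pattern_eq_iff
proof (intro allI ballI impI)
  fix i j a b s
  assume h: "i < n" "j < n" "a \<in> signs" "b \<in> signs" "s \<in> shifts"
  have "p i < n" "p j < n"
    using permutes_in_image[OF assms(2)] h(1,2) by auto
  then show "a * signed_permute S p x i + b * signed_permute S p x j < s \<longleftrightarrow>
      a * signed_permute S p y i + b * signed_permute S p y j < s"
    unfolding signed_permute_sum using h by (intro sign_pattern_eqD[OF assms(1)] signs_flip)
qed

lemma sign_pattern_signed_permute_iff:
  assumes "p permutes {..<n}"
  shows "sign_pattern n (signed_permute S p x) = sign_pattern n (signed_permute S p y) \<longleftrightarrow>
    sign_pattern n x = sign_pattern n y"
  using sign_pattern_signed_permuteI[OF _ assms]
    sign_pattern_signed_permuteI[OF _ permutes_inv[OF assms], of "signed_permute S p x"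
      "signed_permute S p y" "{k. inv p k \<in> S}"]
  unfolding signed_permute_inverse[OF assms] by blast

section \<open>Recovering a signed permutation from a sign pattern\<close>

lemma negatives_cong:
  assumes "sign_pattern n x = sign_pattern n y"
  shows "negatives n x = negatives n y"
proof -
  have "x i < 0 \<longleftrightarrow> y i < 0" if "i < n" for i
    using sign_pattern_eqD[OF assms that that, of 1 1 0] by (simp add: signs_def shifts_def)
  then show ?thesis
    unfolding negatives_def by auto
qed

lemma abs_rank_cong:
  assumes "sign_pattern n x = sign_pattern n y"
  shows "abs_rank n x = abs_rank n y"
proof -
  have "\<bar>x j\<bar> < \<bar>x i\<bar> \<longleftrightarrow> \<bar>y j\<bar> < \<bar>y i\<bar>" if "i < n" "j < n" for i j
  proof -
    have D: "a * x j + b * x i < 0 \<longleftrightarrow> a * y j + b * y i < 0" if "a \<in> signs" "b \<in> signs" for a b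
      using sign_pattern_eqD[OF assms \<open>j < n\<close> \<open>i < n\<close> that, of 0] by (simp add: shifts_def)
    \<comment> \<open>Comparing absolute values is a Boolean combination of the four signed forms at
      level \<open>0\<close>, which the pattern records.\<close>
    have abs_less_abs: "\<bar>u\<bar> < \<bar>v\<bar> \<longleftrightarrow> (u - v < 0 \<and> - u - v < 0) \<or> (u + v < 0 \<and> - u + v < 0)" for u v :: real
      by linarith
    show ?thesis
      unfolding abs_less_abs using D[of 1 1] D[of 1 "-1"] D[of "-1" 1] D[of "-1" "-1"]
      by (simp add: signs_def)
  qed
  then show ?thesis
    unfolding abs_rank_def by (intro ext) (auto intro!: arg_cong[where f = card])
qed

lemma dominant_less_iff:
  assumes "dominant n x" "i < n" "j < n"
  shows "x i < x j \<longleftrightarrow> i < j"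
proof -
  have mono: "x k < x l" if "k < l" "l < n" for k l
    using assms(1) that unfolding dominant_def by blast
  show ?thesis
    using mono[of i j] mono[of j i] assms(2,3) by (cases i j rule: linorder_cases) auto
qed

text \<open>The values of a dominant point are positive and ordered like their indices, so signs and
  ranks reveal \<open>S\<close> and \<open>p\<close>. Since both are invariants of the pattern, the
  action on patterns is free.\<close>

lemma
  assumes x: "dominant n x" and p: "p permutes {..<n}" and S: "S \<subseteq> {..<n}"
  shows negatives_signed_permute: "negatives n (signed_permute S p x) = S"
    and abs_rank_signed_permute: "abs_rank n (signed_permute S p x) = p"
proof -
  have p_less: "p i < n \<longleftrightarrow> i < n" for i
    using permutes_in_image[OF p] by auto
  have pos: "0 < x (p i)" if "i < n" for i
    using x that p_less unfolding dominant_def by blast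
  show "negatives n (signed_permute S p x) = S"
    using pos S unfolding negatives_def signed_permute_def by force
  have abs_eq: "\<bar>signed_permute S p x i\<bar> = x (p i)" if "i < n" for i
    using pos[OF that] by (simp add: signed_permute_def)
  have "abs_rank n (signed_permute S p x) i = p i" for i
  proof (cases "i < n")
    case True
    have less_iff: "\<bar>signed_permute S p x j\<bar> < \<bar>signed_permute S p x i\<bar> \<longleftrightarrow> p j < p i"
      if "j < n" for j
      unfolding abs_eq[OF that] abs_eq[OF True]
      using that True by (intro dominant_less_iff[OF x]) (simp_all only: p_less)
    have "j < n" if "p j < p i" for j
      using less_trans[OF that, of n] True unfolding p_less by blast
    then have "{j. j < n \<and> \<bar>signed_permute S p x j\<bar> < \<bar>signed_permute S p x i\<bar>} = {j. p j < p i}"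
      using less_iff by blast
    also have "\<dots> = p -` {..<p i}" by auto
    also have "card \<dots> = p i"
      using permutes_bij[OF p] by (simp add: card_vimage_inj bij_def)
    finally show ?thesis
      using True by (simp add: abs_rank_def)
  next
    case False
    then show ?thesis
      using permutes_not_in[OF p, of i] by (simp add: abs_rank_def)
  qed
  then show "abs_rank n (signed_permute S p x) = p" by auto
qed

lemma generic_abs_eq_iff:
  assumes x: "generic n x" and "i < n" "j < n"
  shows "\<bar>x i\<bar> = \<bar>x j\<bar> \<longleftrightarrow> i = j"
  using genericD[OF x assms(2,3), of 1 1 0] genericD[OF x assms(2,3), of 1 "-1" 0]
  by (auto simp: signs_def shifts_def abs_eq_iff)

lemma abs_rank_less_iff:
  assumes "i < n" "j < n"
  shows "abs_rank n x i < abs_rank n x j \<longleftrightarrow> \<bar>x i\<bar> < \<bar>x j\<bar>"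
proof -
  have mono: "abs_rank n x i < abs_rank n x j" if "i < n" "j < n" "\<bar>x i\<bar> < \<bar>x j\<bar>" for i j
    unfolding abs_rank_def using that by (auto intro!: psubset_card_mono)
  have "abs_rank n x i = abs_rank n x j" if "\<bar>x i\<bar> = \<bar>x j\<bar>"
    using that assms by (simp add: abs_rank_def)
  then show ?thesis
    using mono[of i j] mono[of j i] assms by (cases "\<bar>x i\<bar>" "\<bar>x j\<bar>" rule: linorder_cases) auto
qed

lemma abs_rank_permutes:
  assumes x: "generic n x"
  shows "abs_rank n x permutes {..<n}"
proof (rule bij_imp_permutes)
  have "inj_on (abs_rank n x) {..<n}"
  proof (rule inj_onI)
    fix i j assume "i \<in> {..<n}" "j \<in> {..<n}" "abs_rank n x i = abs_rank n x j"
    then show "i = j"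
      using generic_abs_eq_iff[OF x, of i j] abs_rank_less_iff[of i n j x]
        abs_rank_less_iff[of j n i x]
      by (metis lessThan_iff linorder_neqE order_less_irrefl)
  qed
  moreover have "abs_rank n x i < n" if "i < n" for i
  proof -
    have "{j. j < n \<and> \<bar>x j\<bar> < \<bar>x i\<bar>} \<subset> {..<n}"
      using that by auto
    then have "card {j. j < n \<and> \<bar>x j\<bar> < \<bar>x i\<bar>} < card {..<n}"
      by (intro psubset_card_mono) auto
    then show ?thesis
      using that by (simp add: abs_rank_def)
  qed
  ultimately show "bij_betw (abs_rank n x) {..<n} {..<n}"
    by (intro bij_betw_imageI endo_inj_surj) auto
qed (simp add: abs_rank_def)

text \<open>The point \<open>z\<close> arises by making all coordinates positive and sorting them by
  absolute value; genericity excludes zeros and ties.\<close>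

lemma generic_eq_signed_permute_dominant:
  assumes x: "generic n x"
  obtains z where "dominant n z" "sign_pattern n (signed_permute (negatives n x) (abs_rank n x) z) = sign_pattern n x"
proof -
  define p where "p = abs_rank n x"
  define q where "q = inv p"
  define z where "z = signed_permute {k. q k \<in> negatives n x} q x"
  have p: "p permutes {..<n}"
    unfolding p_def using x by (rule abs_rank_permutes)
  then have q: "q permutes {..<n}"
    unfolding q_def by (rule permutes_inv)
  have pq: "p (q k) = k" "q (p k) = k" for k
    unfolding q_def using permutes_inverses[OF p] by auto
  have q_less: "q k < n" if "k < n" for k
    using permutes_in_image[OF q] that by auto
  have nonzero: "x i \<noteq> 0" if "i < n" for i
    using genericD[OF x that that, of 1 1 0] by (auto simp: signs_def shifts_def)
  have z_abs: "z k = \<bar>x (q k)\<bar>" if "k < n" for k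
    using q_less[OF that] by (auto simp: z_def signed_permute_def negatives_def)
  have "dominant n z"
    unfolding dominant_def
  proof (intro conjI allI impI)
    show "generic n z"
      unfolding z_def using x q by (rule generic_signed_permute)
    show "0 < z i" if "i < n" for i
      using z_abs[OF that] nonzero[OF q_less[OF that]] by simp
    show "z j < z i" if "i < n" "j < i" for i j
      using that z_abs abs_rank_less_iff[of "q j" n "q i" x] q_less pq
      unfolding p_def by auto
  qed
  moreover have "signed_permute (negatives n x) p z i = x i" for i
    unfolding z_def signed_permute_def by (simp add: pq)
  then have "signed_permute (negatives n x) p z = x" by auto
  ultimately show ?thesis
    using that unfolding p_def by metis
qed

text \<open>\<open>W\<close> encodes the signed permutations and \<open>C w\<close> the patterns in
  the chamber moved by \<open>w\<close>. These sets cover all generic patterns, are disjoint by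
  freeness, and have equal size because the action is injective on patterns.\<close>

lemma card_sign_patterns_generic:
  "card (sign_pattern n ` {x. generic n x}) =
     2 ^ n * fact n * card (sign_pattern n ` {x. dominant n x})"
proof -
  define W where "W = Pow {..<n} \<times> {p. p permutes {..<n}}"
  define C where "C = (\<lambda>(S, p). (\<lambda>x. sign_pattern n (signed_permute S p x)) ` {x. dominant n x})"
  have "sign_pattern n ` {x. generic n x} = (\<Union>w\<in>W. C w)"
  proof (intro equalityI subsetI)
    fix P assume "P \<in> sign_pattern n ` {x. generic n x}"
    then obtain x where x: "generic n x" "P = sign_pattern n x" by auto
    obtain z where z: "dominant n z"
      "sign_pattern n (signed_permute (negatives n x) (abs_rank n x) z) = sign_pattern n x"
      using generic_eq_signed_permute_dominant[OF x(1)] .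
    have "(negatives n x, abs_rank n x) \<in> W"
      unfolding W_def using abs_rank_permutes[OF x(1)] by (auto simp: negatives_def)
    moreover have "P \<in> C (negatives n x, abs_rank n x)"
      unfolding C_def prod.case x(2) z(2)[symmetric] using z(1) by blast
    ultimately show "P \<in> (\<Union>w\<in>W. C w)" by blast
  next
    fix P assume "P \<in> (\<Union>w\<in>W. C w)"
    then show "P \<in> sign_pattern n ` {x. generic n x}"
      unfolding W_def C_def by (auto simp: dominant_def intro!: imageI generic_signed_permute)
  qed
  also have "card \<dots> = (\<Sum>w\<in>W. card (C w))"
  proof (rule card_UN_disjoint)
    show "finite W"
      unfolding W_def by (intro finite_cartesian_product finite_permutations) auto
    show "\<forall>w\<in>W. finite (C w)"
    proof
      fix w
      have "C w = sign_pattern n ` (signed_permute (fst w) (snd w) ` {x. dominant n x})"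
        unfolding C_def by (simp add: image_image split_beta)
      then show "finite (C w)"
        by (simp add: finite_sign_patterns)
    qed
    have "w = v" if w: "w \<in> W" "P \<in> C w" and v: "v \<in> W" "P \<in> C v" for w v P
    proof -
      obtain S p T q where wv: "w = (S, p)" "v = (T, q)" by (metis prod.exhaust)
      obtain x y where "dominant n x" "P = sign_pattern n (signed_permute S p x)"
        "dominant n y" "P = sign_pattern n (signed_permute T q y)"
        using w v unfolding C_def wv by auto
      moreover have "S \<subseteq> {..<n}" "p permutes {..<n}" "T \<subseteq> {..<n}" "q permutes {..<n}"
        using w v unfolding W_def wv by auto
      ultimately show ?thesis
        unfolding wv
        using negatives_signed_permute abs_rank_signed_permute
          negatives_cong[of n "signed_permute S p x" "signed_permute T q y"]
          abs_rank_cong[of n "signed_permute S p x" "signed_permute T q y"]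
        by simp
    qed
    then show "\<forall>w\<in>W. \<forall>v\<in>W. w \<noteq> v \<longrightarrow> C w \<inter> C v = {}" by blast
  qed
  also have "\<dots> = (\<Sum>w\<in>W. card (sign_pattern n ` {x. dominant n x}))"
  proof (intro sum.cong refl)
    fix w assume "w \<in> W"
    then have "snd w permutes {..<n}"
      unfolding W_def by auto
    then show "card (C w) = card (sign_pattern n ` {x. dominant n x})"
      unfolding C_def split_beta
      by (intro card_image_eq_card_image sign_pattern_signed_permute_iff)
  qed
  also have "\<dots> = 2 ^ n * fact n * card (sign_pattern n ` {x. dominant n x})"
    using card_permutations[of "{..<n}" n]
    by (simp add: W_def card_cartesian_product card_Pow)
  finally show ?thesis .
qed

section \<open>Counting in the dominant chamber\<close>

text \<open>Thresholds are named symbolically, so that the sets above a value can be compared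
  between different points. As \<open>0\<close> is not a sign, \<open>(0, 0)\<close> clashes with no
  other label.\<close>

definition labels :: "nat \<Rightarrow> (real \<times> nat) set" where
  "labels n = insert (0, 0) (signs \<times> {..<n})"

text \<open>
  Given a dominant point \<open>x\<close> in dimension \<open>n\<close>, the next coordinate may be any number above all
  previous ones that avoids the values \<open>1/2\<close> and \<open>1 + a * x i\<close> with \<open>a \<in> signs\<close> for \<open>i < n\<close>; the label \<open>(0, 0)\<close>
  stands for \<open>1/2\<close>.
\<close>

definition threshold :: "(nat \<Rightarrow> real) \<Rightarrow> real \<times> nat \<Rightarrow> real" where
  "threshold x = (\<lambda>(a, i). if a = 0 then 1 / 2 else 1 + a * x i)"

definition above :: "nat \<Rightarrow> (nat \<Rightarrow> real) \<Rightarrow> real \<Rightarrow> (real \<times> nat) set" where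
  "above n x c = {l \<in> labels n. c < threshold x l}"

text \<open>The value \<open>0\<close> for \<open>n = 0\<close> encodes that the first coordinate
  only has to be positive.\<close>

definition last_coord :: "nat \<Rightarrow> (nat \<Rightarrow> real) \<Rightarrow> real" where
  "last_coord n x = (if n = 0 then 0 else x (n - 1))"

lemma finite_labels: "finite (labels n)"
  by (simp add: labels_def signs_def)

lemma card_labels: "card (labels n) = 2 * n + 1"
  by (simp add: labels_def signs_def card_cartesian_product)

lemma finite_above: "finite (above n x c)"
  unfolding above_def using finite_labels by simp

lemma labels_cases:
  assumes "l \<in> labels n"
  obtains "l = (0, 0)" | a i where "l = (a, i)" "a \<in> signs" "i < n"
  using assms unfolding labels_def by auto

lemma labels_mem: "(0, 0) \<in> labels n" "a \<in> signs \<Longrightarrow> i < n \<Longrightarrow> (a, i) \<in> labels n"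
  by (simp_all add: labels_def)

lemma signs_simps: "1 \<in> signs" "-1 \<in> signs" "a \<in> signs \<Longrightarrow> - a \<in> signs" "0 \<notin> signs"
  by (auto simp: signs_def)

lemma shifts_simps: "-1 \<in> shifts" "0 \<in> shifts" "1 \<in> shifts"
  by (auto simp: shifts_def)

lemma threshold_half: "threshold x (0, i) = 1 / 2"
  by (simp add: threshold_def)

lemma threshold_sign: "a \<in> signs \<Longrightarrow> threshold x (a, i) = 1 + a * x i"
  by (auto simp: threshold_def signs_def)

lemma threshold_cong:
  assumes "\<And>i. i < n \<Longrightarrow> x i = y i" "l \<in> labels n"
  shows "threshold x l = threshold y l"
  using assms(2,1) by (cases rule: labels_cases) (simp_all add: threshold_half threshold_sign)

lemma above_cong:
  assumes "\<And>i. i < n \<Longrightarrow> x i = y i"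
  shows "above n x c = above n y c"
  unfolding above_def using threshold_cong[of n x y, OF assms] by (intro Collect_cong conj_cong) auto

lemma dominant_mono:
  assumes "dominant n x" "m \<le> n"
  shows "dominant m x"
proof -
  have "generic m x"
    using assms unfolding dominant_def generic_def by simp
  then show ?thesis
    using assms unfolding dominant_def by simp
qed

lemma dominant_cong:
  assumes "\<And>i. i < n \<Longrightarrow> x i = y i"
  shows "dominant n x \<longleftrightarrow> dominant n y"
proof -
  have "dominant n y" if "dominant n x" "\<And>i. i < n \<Longrightarrow> x i = y i" for x y
    using that generic_cong[of n x y] unfolding dominant_def by auto
  from this[of x y] this[of y x] show ?thesis
    using assms by metis
qed

text \<open>After rearranging, comparing two thresholds becomes a signed form tested at level
  \<open>0\<close>, or at level \<open>1\<close> or \<open>-1\<close> if one of them is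
  \<open>1/2\<close>.\<close>

lemma threshold_less_cong:
  assumes eq: "sign_pattern n x = sign_pattern n y" and l: "l \<in> labels n" "l' \<in> labels n"
  shows "threshold x l < threshold x l' \<longleftrightarrow> threshold y l < threshold y l'"
  using l(1)
proof (cases rule: labels_cases)
  case 1
  show ?thesis
    using l(2)
  proof (cases rule: labels_cases)
    case (2 b j)
    have "- b * x j + - b * x j < 1 \<longleftrightarrow> - b * y j + - b * y j < 1"
      by (intro sign_pattern_eqD[OF eq] 2 signs_simps shifts_simps)
    then show ?thesis
      unfolding 1 2(1) threshold_half threshold_sign[OF 2(2)] by simp argo
  qed (simp add: 1 threshold_half)
next
  case i: (2 a i)
  show ?thesis
    using l(2)
  proof (cases rule: labels_cases)
    case 1
    have "a * x i + a * x i < -1 \<longleftrightarrow> a * y i + a * y i < -1"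
      by (intro sign_pattern_eqD[OF eq] i signs_simps shifts_simps)
    then show ?thesis
      unfolding i(1) 1 threshold_half threshold_sign[OF i(2)] by simp argo
  next
    case (2 b j)
    have "a * x i + - b * x j < 0 \<longleftrightarrow> a * y i + - b * y j < 0"
      by (intro sign_pattern_eqD[OF eq] i 2 signs_simps shifts_simps)
    then show ?thesis
      unfolding i(1) 2(1) threshold_sign[OF i(2)] threshold_sign[OF 2(2)] by simp
  qed
qed

text \<open>Lying below a threshold means \<open>x k - a * x i < 1\<close> or
  \<open>2 * x k < 1\<close>, both recorded in the pattern. It serves for the last coordinate among
  all labels and for a new coordinate among the old labels.\<close>

lemma above_coord_cong:
  assumes eq: "sign_pattern n x = sign_pattern n y" and "k < n" "m \<le> n"
  shows "above m x (x k) = above m y (y k)"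
proof -
  have "x k < threshold x l \<longleftrightarrow> y k < threshold y l" if "l \<in> labels m" for l
    using that
  proof (cases rule: labels_cases)
    case 1
    have "1 * x k + 1 * x k < 1 \<longleftrightarrow> 1 * y k + 1 * y k < 1"
      by (intro sign_pattern_eqD[OF eq] \<open>k < n\<close> signs_simps shifts_simps)
    then show ?thesis
      unfolding 1 threshold_half by simp argo
  next
    case (2 a i)
    have "i < n"
      using 2 \<open>m \<le> n\<close> by simp
    have "1 * x k + - a * x i < 1 \<longleftrightarrow> 1 * y k + - a * y i < 1"
      by (intro sign_pattern_eqD[OF eq] \<open>k < n\<close> \<open>i < n\<close> 2 signs_simps shifts_simps)
    then show ?thesis
      unfolding 2(1) threshold_sign[OF 2(2)] by (simp add: algebra_simps)
  qed
  then show ?thesis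
    unfolding above_def by blast
qed

lemma above_last_coord_cong:
  assumes eq: "sign_pattern n x = sign_pattern n y"
  shows "above n x (last_coord n x) = above n y (last_coord n y)"
proof (cases n)
  case 0
  then show ?thesis
    by (auto simp: above_def last_coord_def labels_def threshold_half)
next
  case (Suc m)
  then show ?thesis
    using above_coord_cong[OF eq, of m n] by (simp add: last_coord_def)
qed

text \<open>Upper sets of a finite linear order are nested, so their cardinality determines them.\<close>

lemma above_eqI:
  assumes eq: "sign_pattern n x = sign_pattern n y"
    and card: "card (above n x c) = card (above n y d)"
  shows "above n x c = above n y d"
proof -
  have "above n x c \<subseteq> above n y d \<or> above n y d \<subseteq> above n x c"
  proof (rule ccontr)
    assume "\<not> ?thesis"
    then obtain l l' where l: "l \<in> above n x c" "l \<notin> above n y d" "l' \<in> above n y d" "l' \<notin> above n x c"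
      by blast
    then have lab: "l \<in> labels n" "l' \<in> labels n"
      unfolding above_def by auto
    have "threshold x l' < threshold x l" "\<not> threshold y l' < threshold y l"
      using l lab unfolding above_def by auto
    then show False
      using threshold_less_cong[OF eq lab(2,1)] by simp
  qed
  then show ?thesis
    using card finite_above by (metis card_subset_eq)
qed

section \<open>Appending one coordinate to a dominant point\<close>

lemma last_coord_upper:
  assumes "dominant n x" "i < n"
  shows "x i \<le> last_coord n x"
  using assms dominant_less_iff[OF assms(1), of i "n - 1"]
  by (cases "i = n - 1") (auto simp: last_coord_def)

lemma last_coord_nonneg:
  assumes "dominant n x"
  shows "0 \<le> last_coord n x"
  using assms by (auto simp: last_coord_def dominant_def intro: less_imp_le)

text \<open>Coinciding thresholds would put \<open>x\<close> on a hyperplane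
  \<open>2 * x i = s\<close> or \<open>x i = \<plusminus> x j\<close>. Hence counting labels is the
  same as counting threshold values.\<close>

lemma inj_on_threshold:
  assumes "generic n x"
  shows "inj_on (threshold x) (labels n)"
proof (rule inj_onI)
  fix l l' assume l: "l \<in> labels n" "l' \<in> labels n" and eq: "threshold x l = threshold x l'"
  have half: "threshold x (0, 0) \<noteq> threshold x (a, i)" if a: "a \<in> signs" and i: "i < n" for a i
  proof -
    have "a * x i + a * x i \<noteq> -1"
      using a i by (intro genericD[OF assms] shifts_simps refl)
    then show ?thesis
      unfolding threshold_half threshold_sign[OF a] by auto
  qed
  have same: "(a, i) = (b, j)"
    if a: "a \<in> signs" "i < n" and b: "b \<in> signs" "j < n" and eq: "threshold x (a, i) = threshold x (b, j)"
    for a i b j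
  proof -
    have sum: "a * x i + - b * x j = 0"
      using eq unfolding threshold_sign[OF a(1)] threshold_sign[OF b(1)] by simp
    \<comment> \<open>The vanishing form contradicts genericity unless it is the zero form, with
      equal indices and opposite signs \<open>a\<close> and \<open>- b\<close>.\<close>
    then have "i = j"
      using genericD[OF assms a(2) b(2) a(1) signs_simps(3)[OF b(1)] shifts_simps(2)] by auto
    moreover have "a \<noteq> - b"
      using genericD[OF assms a(2) b(2) a(1) signs_simps(3)[OF b(1)] shifts_simps(2)] sum by auto
    ultimately show ?thesis
      using a(1) b(1) by (auto simp: signs_def)
  qed
  show "l = l'"
    using l(1)
  proof (cases rule: labels_cases)
    case l1: 1
    show ?thesis
      using l(2)
    proof (cases rule: labels_cases)
      case (2 b j)
      then show ?thesis
        using half[OF 2(2,3)] eq l1 by simp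
    qed (simp add: l1)
  next
    case l2: (2 a i)
    show ?thesis
      using l(2)
    proof (cases rule: labels_cases)
      case 1
      then show ?thesis
        using half[OF l2(2,3)] eq l2(1) by simp
    next
      case (2 b j)
      show ?thesis
        unfolding l2(1) 2(1) using same[OF l2(2,3) 2(2,3)] eq unfolding l2(1) 2(1) .
    qed
  qed
qed

text \<open>Since \<open>0 < x i < x n\<close>, the only new hyperplanes that could be hit are
  \<open>x n - x i = 1\<close>, \<open>x n + x i = 1\<close> and \<open>2 * x n = 1\<close>, which
  are the thresholds.\<close>

lemma dominant_SucI:
  assumes x: "dominant n x" and last: "last_coord n x < x n"
    and avoid: "x n \<notin> threshold x ` labels n"
  shows "dominant (Suc n) x"
proof -
  have pos: "0 < x n"
    using last last_coord_nonneg[OF x] by simp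
  have less: "0 < x i" "x i < x n" if "i < n" for i
    using last last_coord_upper[OF x that] x that unfolding dominant_def by auto
  have half: "x n \<noteq> 1 / 2"
    using avoid imageI[OF labels_mem(1), of "threshold x" n] unfolding threshold_half by metis
  have other: "x n \<noteq> 1 + a * x i" if "a \<in> signs" "i < n" for a i
    using avoid imageI[OF labels_mem(2)[OF that], of "threshold x"] that
    by (auto simp: threshold_sign)
  have mixed: "a * x i + b * x n \<noteq> s" if "i < n" "a \<in> signs" "b \<in> signs" "s \<in> shifts" for i a b s
    using less[OF that(1)] other[OF signs_simps(1) that(1)] other[OF signs_simps(2) that(1)] that(2-4)
    by (auto simp: signs_def shifts_def)
  have "generic (Suc n) x"
    unfolding generic_def
  proof (intro allI impI ballI)
    fix i j a b s
    assume h: "i < Suc n" "j < Suc n" "a \<in> signs" "b \<in> signs" "s \<in> shifts" "i = j \<longrightarrow> a = b"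
    consider "i < n" "j < n" | "i < n" "j = n" | "i = n" "j < n" | "i = n" "j = n"
      using h(1,2) by linarith
    then show "a * x i + b * x j \<noteq> s"
    proof cases
      case 1
      then show ?thesis
        using x genericD[OF _ 1 h(3-5)] h(6) unfolding dominant_def by blast
    next
      case 2
      then show ?thesis
        using mixed[OF 2(1) h(3-5)] by simp
    next
      case 3
      then show ?thesis
        using mixed[OF 3(2) h(4,3,5)] by (simp add: add.commute)
    next
      case 4
      then show ?thesis
        using half pos h(3-6) by (auto simp: signs_def shifts_def)
    qed
  qed
  moreover have "\<forall>i<Suc n. 0 < x i"
    using less pos by (auto simp: less_Suc_eq)
  moreover have "\<forall>i<Suc n. \<forall>j<i. x j < x i"
    using less x by (auto simp: less_Suc_eq dominant_def)
  ultimately show ?thesis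
    unfolding dominant_def by blast
qed

lemma last_coord_less:
  assumes "dominant (Suc n) x"
  shows "last_coord n x < x n"
  using assms by (auto simp: dominant_def last_coord_def)

text \<open>Positivity and the ordering settle all new comparisons except those of
  \<open>x n - x i\<close>, \<open>x n + x i\<close> and \<open>2 * x n\<close> with
  \<open>1\<close>, and these are the membership conditions of \<open>above\<close>.\<close>

lemma sign_pattern_Suc_eqI:
  assumes x: "dominant (Suc n) x" and y: "dominant (Suc n) y"
    and eq: "sign_pattern n x = sign_pattern n y"
    and above: "above n x (x n) = above n y (y n)"
  shows "sign_pattern (Suc n) x = sign_pattern (Suc n) y"
proof -
  have mem_above: "2 * z n < 1 \<longleftrightarrow> (0, 0) \<in> above n z (z n)"
    "i < n \<Longrightarrow> z n - z i < 1 \<longleftrightarrow> (1, i) \<in> above n z (z n)"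
    "i < n \<Longrightarrow> z n + z i < 1 \<longleftrightarrow> (-1, i) \<in> above n z (z n)" for z i
    using threshold_sign[of 1 z i] threshold_sign[of "-1" z i]
    by (auto simp: above_def labels_mem signs_simps threshold_half)
  \<comment> \<open>Excluding the value \<open>1\<close> makes a negated form at level
    \<open>-1\<close> the exact complement of the form at level \<open>1\<close>.\<close>
  have pos: "0 < z n" "0 < z i" "z i < z n" "z n - z i \<noteq> 1" "z n + z i \<noteq> 1"
    if "dominant (Suc n) z" "i < n" for z i
    using that genericD[of "Suc n" z n i 1 "-1" 1] genericD[of "Suc n" z n i 1 1 1]
    unfolding dominant_def by (auto simp: signs_simps shifts_simps)
  have mixed: "a * x i + b * x n < s \<longleftrightarrow> a * y i + b * y n < s"
    if i: "i < n" and h: "a \<in> signs" "b \<in> signs" "s \<in> shifts" for i a b s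
  proof -
    have "x n - x i < 1 \<longleftrightarrow> y n - y i < 1" "x n + x i < 1 \<longleftrightarrow> y n + y i < 1"
      unfolding mem_above(2,3)[OF i] above by simp_all
    then show ?thesis
      using h pos[OF x i] pos[OF y i] by (auto simp: signs_def shifts_def)
  qed
  have single: "a * x n + b * x n < s \<longleftrightarrow> a * y n + b * y n < s"
    if h: "a \<in> signs" "b \<in> signs" "s \<in> shifts" for a b s
  proof -
    have "0 < z n \<and> 2 * z n \<noteq> 1" if "dominant (Suc n) z" for z
      using that genericD[of "Suc n" z n n 1 1 1]
      unfolding dominant_def by (auto simp: signs_def shifts_def)
    from this[OF x] this[OF y] have "0 < x n" "2 * x n \<noteq> 1" "0 < y n" "2 * y n \<noteq> 1" by auto
    moreover have "2 * x n < 1 \<longleftrightarrow> 2 * y n < 1"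
      unfolding mem_above(1) above by simp
    ultimately show ?thesis
      using h by (auto simp: signs_def shifts_def)
  qed
  show ?thesis
    unfolding sign_pattern_eq_iff
  proof (intro allI impI ballI)
    fix i j a b s
    assume h: "i < Suc n" "j < Suc n" "a \<in> signs" "b \<in> signs" "s \<in> shifts"
    consider "i < n" "j < n" | "i < n" "j = n" | "i = n" "j < n" | "i = n" "j = n"
      using h(1,2) by linarith
    then show "a * x i + b * x j < s \<longleftrightarrow> a * y i + b * y j < s"
    proof cases
      case 1
      then show ?thesis
        using sign_pattern_eqD[OF eq 1 h(3-5)] by simp
    next
      case 2
      then show ?thesis
        using mixed[OF 2(1) h(3-5)] by simp
    next
      case 3
      then show ?thesis
        using mixed[OF 3(2) h(4,3,5)] by (simp add: add.commute)
    next
      case 4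
      then show ?thesis
        using single[OF h(3-5)] by simp
    qed
  qed
qed

text \<open>
  If all coordinates are below \<open>1/2\<close> then all thresholds, including the two new ones, lie above
  the last coordinate \<open>x n\<close>. Otherwise, \<open>1 + x n\<close> is the only new threshold above it.
\<close>

lemma card_above_Suc:
  assumes x: "dominant (Suc n) x"
  shows "card (above (Suc n) x (x n)) =
    (if card (above n x (x n)) = 2 * n + 1 then 2 * n + 3 else card (above n x (x n)) + 1)"
proof -
  have pos: "0 < x n"
    using x unfolding dominant_def by blast
  have less: "0 < x i" "x i < x n" if "i < n" for i
    using x that unfolding dominant_def by auto
  have labels_Suc: "labels (Suc n) = insert (1, n) (insert (-1, n) (labels n))"
    unfolding labels_def signs_def lessThan_Suc by auto
  have new: "(1, n) \<notin> labels n" "(-1, n) \<notin> labels n"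
    unfolding labels_def by auto
  \<comment> \<open>There are \<open>2 * n + 1\<close> old labels. If \<open>1/2\<close> is above
    \<open>x n\<close>, so is every \<open>1 - x i\<close>, because
    \<open>x i < x n < 1/2\<close>.\<close>
  have full: "card (above n x (x n)) = 2 * n + 1 \<longleftrightarrow> x n < 1 / 2"
  proof
    assume "card (above n x (x n)) = 2 * n + 1"
    then have "above n x (x n) = labels n"
      using card_subset_eq[OF finite_labels, of "above n x (x n)" n] card_labels[of n]
      unfolding above_def by auto
    then have "(0, 0) \<in> above n x (x n)"
      using labels_mem(1) by simp
    then show "x n < 1 / 2"
      unfolding above_def threshold_half[symmetric, of x 0] by simp
  next
    assume half: "x n < 1 / 2"
    have "x n < threshold x l" if "l \<in> labels n" for l
      using that
    proof (cases rule: labels_cases)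
      case (2 a i)
      then show ?thesis
        using less[of i] half unfolding 2(1) threshold_sign[OF 2(2)] by (auto simp: signs_def)
    qed (use half in \<open>simp add: threshold_half\<close>)
    then have "above n x (x n) = labels n"
      unfolding above_def by auto
    then show "card (above n x (x n)) = 2 * n + 1"
      by (simp add: card_labels)
  qed
  show ?thesis
  proof (cases "x n < 1 / 2")
    case True
    then have "above (Suc n) x (x n) = insert (1, n) (insert (-1, n) (above n x (x n)))"
      using labels_Suc pos unfolding above_def by (auto simp: threshold_sign signs_simps)
    then show ?thesis
      using True full new finite_above[of n x "x n"] unfolding above_def by simp
  next
    case False
    then have "above (Suc n) x (x n) = insert (1, n) (above n x (x n))"
      using labels_Suc pos unfolding above_def by (auto simp: threshold_sign signs_simps)
    then show ?thesis
      using False full new finite_above[of n x "x n"] unfolding above_def by simp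
  qed
qed

text \<open>Induction on the number of points of \<open>T\<close> to be skipped; when none is left,
  any value between \<open>c\<close> and the next point of \<open>T\<close> works.\<close>

lemma exists_between_with_card_above:
  fixes T :: "real set"
  assumes T: "finite T" and "j \<le> card {t \<in> T. c < t}"
  shows "\<exists>v>c. v \<notin> T \<and> card {t \<in> T. v < t} = j"
  using assms(2)
proof (induction "card {t \<in> T. c < t} - j" arbitrary: c)
  case 0
  then have card: "card {t \<in> T. c < t} = j" by simp
  obtain v where v: "c < v" "\<And>t. t \<in> T \<Longrightarrow> c < t \<Longrightarrow> v < t"
  proof (cases "{t \<in> T. c < t} = {}")
    case True
    show ?thesis
      by (rule that[of "c + 1"]) (use True in auto)
  next
    case False
    then have "c < Min {t \<in> T. c < t}"
      using T by simp
    then obtain v where "c < v" "v < Min {t \<in> T. c < t}"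
      using dense by blast
    moreover have "Min {t \<in> T. c < t} \<le> t" if "t \<in> T" "c < t" for t
      using T that by simp
    ultimately show ?thesis
      using that[of v] less_le_trans by blast
  qed
  then have "{t \<in> T. v < t} = {t \<in> T. c < t}" "v \<notin> T"
    using less_trans by auto
  then show ?case
    using v(1) card by auto
next
  case (Suc d)
  define U where "U = {t \<in> T. c < t}"
  have U: "finite U" "U \<noteq> {}"
    using T Suc.hyps(2) unfolding U_def by force+
  \<comment> \<open>Restarting from the least point above \<open>c\<close> skips exactly one
    point.\<close>
  define m where "m = Min U"
  have m: "m \<in> U" "\<And>t. t \<in> U \<Longrightarrow> m \<le> t"
    unfolding m_def using U by auto
  then have "{t \<in> T. m < t} = U - {m}"
    unfolding U_def by force
  then have "card {t \<in> T. m < t} = card U - 1"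
    using m(1) by simp
  then have "d = card {t \<in> T. m < t} - j" "j \<le> card {t \<in> T. m < t}"
    using Suc.hyps(2) Suc.prems unfolding U_def by auto
  from Suc.hyps(1)[OF this] show ?case
    using m(1) unfolding U_def by (metis (lifting) less_trans mem_Collect_eq)
qed

lemma exists_dominant_extension:
  assumes x: "dominant n x" and j: "j \<le> card (above n x (last_coord n x))"
  obtains v where "dominant (Suc n) (x(n := v))" "card (above n x v) = j"
proof -
  have card_eq: "card {t \<in> threshold x ` labels n. c < t} = card (above n x c)" for c
  proof -
    have "{t \<in> threshold x ` labels n. c < t} = threshold x ` above n x c"
      unfolding above_def by auto
    moreover have "inj_on (threshold x) (above n x c)"
      by (rule inj_on_subset[OF inj_on_threshold[of n]])
        (use x in \<open>auto simp: dominant_def above_def\<close>)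
    ultimately show ?thesis
      by (simp add: card_image)
  qed
  obtain v where v: "last_coord n x < v" "v \<notin> threshold x ` labels n" "card (above n x v) = j"
    using exists_between_with_card_above[of "threshold x ` labels n" j "last_coord n x"] finite_labels j
    unfolding card_eq by auto
  have "dominant n (x(n := v))"
    using x dominant_cong[of n x "x(n := v)"] by simp
  moreover have "last_coord n (x(n := v)) < v"
    using v(1) by (auto simp: last_coord_def)
  moreover have "threshold (x(n := v)) ` labels n = threshold x ` labels n"
    by (intro image_cong refl threshold_cong) auto
  ultimately have "dominant (Suc n) (x(n := v))"
    using v(2) by (intro dominant_SucI) auto
  then show ?thesis
    using v(3) that by blast
qed

text \<open>
  The number of ways to append \<open>m\<close> coordinates to a dominant point in dimension \<open>n\<close> for which
  \<open>k\<close> thresholds lie above its last coordinate.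
\<close>

fun num_extensions :: "nat \<Rightarrow> nat \<Rightarrow> nat \<Rightarrow> nat" where
  "num_extensions 0 n k = 1"
| "num_extensions (Suc m) n k =
     (\<Sum>j\<le>k. num_extensions m (Suc n) (if j = 2 * n + 1 then 2 * n + 3 else j + 1))"

text \<open>Induction on \<open>m\<close>, splitting by the number \<open>j\<close> of old
  thresholds above the coordinate \<open>n\<close>. Each \<open>j \<le> k\<close> is realised, and
  together with the old pattern it determines the pattern in dimension \<open>Suc n\<close>, so one
  representative \<open>z j\<close> per class suffices.\<close>

lemma card_sign_patterns_extending:
  assumes "dominant n x"
  shows "card (sign_pattern (n + m) ` {y. dominant (n + m) y \<and> sign_pattern n y = sign_pattern n x}) =
    num_extensions m n (card (above n x (last_coord n x)))"
  using assms
proof (induction m arbitrary: n x)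
  case 0
  then have "sign_pattern n ` {y. dominant n y \<and> sign_pattern n y = sign_pattern n x} =
      {sign_pattern n x}"
    by auto
  then show ?case by simp
next
  case (Suc m)
  define k where "k = card (above n x (last_coord n x))"
  have "\<exists>v. dominant (Suc n) (x(n := v)) \<and> card (above n x v) = j" if "j \<le> k" for j
    using exists_dominant_extension[OF Suc.prems, of j] that unfolding k_def by blast
  then obtain v where v: "\<And>j. j \<le> k \<Longrightarrow> dominant (Suc n) (x(n := v j))"
    "\<And>j. j \<le> k \<Longrightarrow> card (above n x (v j)) = j"
    by metis
  define z where "z j = x(n := v j)" for j
  have z: "dominant (Suc n) (z j)" "card (above n (z j) (z j n)) = j" if "j \<le> k" for j
    using v[OF that] above_cong[of n "z j" x] unfolding z_def by auto
  have z_pattern: "sign_pattern n (z j) = sign_pattern n x" for j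
    by (rule sign_pattern_cong) (simp add: z_def)
  define C where "C j = sign_pattern (Suc n + m) `
      {y. dominant (Suc n + m) y \<and> sign_pattern (Suc n) y = sign_pattern (Suc n) (z j)}" for j
  have "sign_pattern (n + Suc m) ` {y. dominant (n + Suc m) y \<and> sign_pattern n y = sign_pattern n x} =
      (\<Union>j\<in>{..k}. C j)"
  proof (intro equalityI subsetI)
    fix P
    assume "P \<in> sign_pattern (n + Suc m) ` {y. dominant (n + Suc m) y \<and> sign_pattern n y = sign_pattern n x}"
    then obtain y where y: "dominant (Suc n + m) y" "sign_pattern n y = sign_pattern n x"
      "P = sign_pattern (Suc n + m) y"
      by auto
    define j where "j = card (above n y (y n))"
    have y_dom: "dominant (Suc n) y"
      using y(1) by (rule dominant_mono) simp
    \<comment> \<open>The new coordinate exceeds the last one, so it cannot have more thresholds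
      above it; this bounds \<open>j\<close> by \<open>k\<close>.\<close>
    have "above n y (y n) \<subseteq> above n y (last_coord n y)"
      using last_coord_less[OF y_dom] unfolding above_def by auto
    then have "j \<le> card (above n y (last_coord n y))"
      unfolding j_def using finite_above card_mono by blast
    then have "j \<le> k"
      unfolding k_def above_last_coord_cong[OF y(2)] .
    have pat: "sign_pattern n y = sign_pattern n (z j)"
      using y(2) z_pattern by simp
    have "sign_pattern (Suc n) y = sign_pattern (Suc n) (z j)"
    proof (rule sign_pattern_Suc_eqI[OF y_dom z(1)[OF \<open>j \<le> k\<close>] pat])
      show "above n y (y n) = above n (z j) (z j n)"
        by (rule above_eqI[OF pat]) (simp only: z(2)[OF \<open>j \<le> k\<close>] flip: j_def)
    qed
    then have "P \<in> C j"
      unfolding C_def y(3) using y(1) by blast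
    then show "P \<in> (\<Union>j\<in>{..k}. C j)"
      using \<open>j \<le> k\<close> by blast
  next
    fix P assume "P \<in> (\<Union>j\<in>{..k}. C j)"
    then obtain j y where y: "dominant (Suc n + m) y"
      "sign_pattern (Suc n) y = sign_pattern (Suc n) (z j)" "P = sign_pattern (Suc n + m) y"
      unfolding C_def by blast
    have "sign_pattern n y = sign_pattern n x"
      using sign_pattern_eq_mono[OF y(2), of n] z_pattern by simp
    then show "P \<in> sign_pattern (n + Suc m) ` {y. dominant (n + Suc m) y \<and> sign_pattern n y = sign_pattern n x}"
      using y(1,3) by auto
  qed
  also have "card \<dots> = (\<Sum>j\<le>k. card (C j))"
  proof (rule card_UN_disjoint)
    show "\<forall>j\<in>{..k}. finite (C j)"
      unfolding C_def using finite_sign_patterns by blast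
    have "i = j" if ij: "i \<le> k" "j \<le> k" and P: "P \<in> C i" "P \<in> C j" for i j P
    proof -
      obtain y where y: "sign_pattern (Suc n) y = sign_pattern (Suc n) (z i)" "P = sign_pattern (Suc n + m) y"
        using P(1) unfolding C_def by blast
      obtain w where w: "sign_pattern (Suc n) w = sign_pattern (Suc n) (z j)" "P = sign_pattern (Suc n + m) w"
        using P(2) unfolding C_def by blast
      have "sign_pattern (Suc n + m) y = sign_pattern (Suc n + m) w"
        using y(2) w(2) by simp
      then have "sign_pattern (Suc n) y = sign_pattern (Suc n) w"
        by (rule sign_pattern_eq_mono) simp
      then have "sign_pattern (Suc n) (z i) = sign_pattern (Suc n) (z j)"
        using y(1) w(1) by simp
      \<comment> \<open>The position of the new coordinate is an invariant of the extended pattern,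
        which separates the classes.\<close>
      then have "above n (z i) (z i n) = above n (z j) (z j n)"
        by (rule above_coord_cong) simp_all
      from arg_cong[OF this, of card] show "i = j"
        unfolding z(2)[OF ij(1)] z(2)[OF ij(2)] .
    qed
    then show "\<forall>i\<in>{..k}. \<forall>j\<in>{..k}. i \<noteq> j \<longrightarrow> C i \<inter> C j = {}"
      by (metis atMost_iff disjoint_iff)
  qed simp
  also have "\<dots> = (\<Sum>j\<le>k. num_extensions m (Suc n) (if j = 2 * n + 1 then 2 * n + 3 else j + 1))"
  proof (intro sum.cong refl)
    fix j assume "j \<in> {..k}"
    then have j: "j \<le> k" by simp
    have "last_coord (Suc n) (z j) = z j n"
      by (simp add: last_coord_def)
    then show "card (C j) = num_extensions m (Suc n) (if j = 2 * n + 1 then 2 * n + 3 else j + 1)"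
      unfolding C_def Suc.IH[OF z(1)[OF j]] by (simp only: card_above_Suc[OF z(1)[OF j]] z(2)[OF j])
  qed
  finally show ?case
    unfolding k_def by simp
qed

section \<open>Closed forms for the succession rule\<close>

text \<open>For \<open>k \<le> 2 * n\<close> the exceptional child \<open>2 * n + 1\<close> never
  occurs, and \<open>j + 1 \<le> 2 * Suc n\<close> keeps it so. What remains is the plain ballot
  recurrence, whose solution does not depend on \<open>n\<close>.\<close>

lemma num_extensions_partial:
  assumes "k \<le> 2 * n"
  shows "int (num_extensions m n k) =
    int ((2 * m + k) choose (m + k)) - int ((2 * m + k) choose (m + k + 1))"
  using assms
proof (induction m arbitrary: n k)
  case 0
  then show ?case by (simp add: binomial_eq_0)
next
  case (Suc m)
  have IH: "int (num_extensions m (Suc n) (if j = 2 * n + 1 then 2 * n + 3 else j + 1)) =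
      int ((2 * m + j + 1) choose (m + j + 1)) - int ((2 * m + j + 1) choose (m + j + 2))"
    if "j \<le> k" for j
    using Suc.IH[of "j + 1" "Suc n"] that Suc.prems by simp
  have telescope: "(\<Sum>j\<le>k. int ((2 * m + j + 1) choose (m + j + 1)) - int ((2 * m + j + 1) choose (m + j + 2))) =
      int ((2 * m + k + 2) choose (m + k + 1)) - int ((2 * m + k + 2) choose (m + k + 2))" for k
  proof (induction k)
    case 0
    \<comment> \<open>Pascal's rule drives the telescoping; its initial value needs the symmetry of
      the two middle coefficients.\<close>
    have "(2 * m + 1) choose m = (2 * m + 1) choose (m + 1)"
      using binomial_symmetric[of m "2 * m + 1"] by simp
    then show ?case
      by simp
  next
    case (Suc k)
    then show ?case
      by simp
  qed
  have "int (num_extensions (Suc m) n k) =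
      (\<Sum>j\<le>k. int ((2 * m + j + 1) choose (m + j + 1)) - int ((2 * m + j + 1) choose (m + j + 2)))"
    unfolding num_extensions.simps of_nat_sum using IH by (intro sum.cong) auto
  then show ?case
    unfolding telescope by simp
qed

text \<open>The children \<open>j \<le> 2 * n\<close> contribute a ballot number, and the last child
  is full again, as \<open>2 * n + 3 = 2 * Suc n + 1\<close>. By induction its count is exactly the
  binomial subtracted in the ballot number.\<close>

lemma num_extensions_full: "num_extensions m n (2 * n + 1) = (2 * m + 2 * n) choose (m + 2 * n)"
proof (induction m arbitrary: n)
  case 0
  then show ?case by simp
next
  case (Suc m)
  have "num_extensions (Suc m) n (2 * n + 1) =
      num_extensions (Suc m) n (2 * n) + num_extensions m (Suc n) (2 * Suc n + 1)"
    by (simp add: numeral_3_eq_3)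
  moreover have "int (num_extensions (Suc m) n (2 * n)) =
      int ((2 * Suc m + 2 * n) choose (Suc m + 2 * n)) - int ((2 * Suc m + 2 * n) choose (Suc m + 2 * n + 1))"
    by (rule num_extensions_partial) simp
  moreover have "num_extensions m (Suc n) (2 * Suc n + 1) =
      (2 * Suc m + 2 * n) choose (Suc m + 2 * n + 1)"
    unfolding Suc.IH by (simp add: algebra_simps)
  ultimately show ?case
    by linarith
qed

lemma card_sign_patterns_dominant: "card (sign_pattern n ` {x. dominant n x}) = (2 * n) choose n"
proof -
  have "dominant 0 (\<lambda>_. 0)"
    by (simp add: dominant_def generic_def)
  moreover have "sign_pattern 0 y = sign_pattern 0 (\<lambda>_. 0)" for y
    by (simp add: sign_pattern_eq_iff)
  \<comment> \<open>The root has one threshold, \<open>1/2\<close>, above the value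
    \<open>0\<close>, so it is full: \<open>1 = 2 * 0 + 1\<close>.\<close>
  moreover have "above 0 (\<lambda>_. 0) (last_coord 0 (\<lambda>_. 0)) = {(0, 0)}"
    by (auto simp: above_def labels_def last_coord_def threshold_half)
  ultimately show ?thesis
    using card_sign_patterns_extending[of 0 "\<lambda>_. 0" n] num_extensions_full[of n 0] by simp
qed

theorem proposition3p2:
  fixes n :: nat
  assumes "n \<ge> 1"
  shows "num_regions n (type_C_Catalan n) = 2 ^ n * fact n * ((2 * n) choose n)"
  by (simp add: num_regions_eq_card_sign_patterns card_sign_patterns_generic
      card_sign_patterns_dominant)

end
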